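(* Let $G$ be a finite or infinite connected graph with maximum valence 3. If $G$ has a vertex of valence 1, then $D(G)\le 2$ or $G$ is isomorphic to $T_n$ for some $n\ge 1$.
   Context: $D(G)$ is the least number of colors in a vertex coloring of $G$ whose only color-preserving automorphism is the identity. For $n\ge1$, $T_n$ is the finite tree in which every vertex has valence 1 or 3 and every vertex of valence 1 has distance exactly $n$ from a fixed root vertex. *)

theory Defs
  imports Main "HOL-Library.Extended_Nat"
begin

text \<open>Graphs are simple and undirected, with a possibly infinite vertex set; every edge is
  recorded as both ordered pairs.\<close>

record 'a graph =
  verts :: "'a set"
  edges :: "('a \<times> 'a) set"

definition simple_graph :: "'a graph \<Rightarrow> bool" where
  "simple_graph G \<longleftrightarrow>
     edges G \<subseteq> verts G \<times> verts G \<and> sym (edges G) \<and> irrefl (edges G)"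

definition connected_graph :: "'a graph \<Rightarrow> bool" where
  "connected_graph G \<longleftrightarrow>
     verts G \<noteq> {} \<and> (\<forall>u\<in>verts G. \<forall>v\<in>verts G. (u, v) \<in> (edges G)\<^sup>*)"

definition neighbors :: "'a graph \<Rightarrow> 'a \<Rightarrow> 'a set" where
  "neighbors G v = {w. (v, w) \<in> edges G}"

text \<open>Since \<^const>\<open>card\<close> is 0 on infinite sets, upper bounds on the valence must be
  accompanied by a finiteness condition.\<close>

definition valence :: "'a graph \<Rightarrow> 'a \<Rightarrow> nat" where
  "valence G v = card (neighbors G v)"

definition has_max_valence :: "'a graph \<Rightarrow> nat \<Rightarrow> bool" where
  "has_max_valence G d \<longleftrightarrow>
     (\<forall>v\<in>verts G. finite (neighbors G v) \<and> valence G v \<le> d) \<and>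
     (\<exists>v\<in>verts G. valence G v = d)"

definition graph_iso :: "'a graph \<Rightarrow> 'b graph \<Rightarrow> ('a \<Rightarrow> 'b) \<Rightarrow> bool" where
  "graph_iso G H f \<longleftrightarrow>
     bij_betw f (verts G) (verts H) \<and>
     (\<forall>u\<in>verts G. \<forall>v\<in>verts G. (u, v) \<in> edges G \<longleftrightarrow> (f u, f v) \<in> edges H)"

definition isomorphic :: "'a graph \<Rightarrow> 'b graph \<Rightarrow> bool" where
  "isomorphic G H \<longleftrightarrow> (\<exists>f. graph_iso G H f)"

text \<open>Colorings need not be proper. Colorings and automorphisms are total functions of which only
  the values on the vertex set matter.\<close>

definition distinguishing :: "'a graph \<Rightarrow> ('a \<Rightarrow> 'c) \<Rightarrow> bool" where
  "distinguishing G c \<longleftrightarrow>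
     (\<forall>f. graph_iso G G f \<and> (\<forall>v\<in>verts G. c (f v) = c v) \<longrightarrow> (\<forall>v\<in>verts G. f v = v))"

text \<open>The value is \<open>\<infinity>\<close> if no coloring with finitely many colors is distinguishing.\<close>

definition distinguishing_number :: "'a graph \<Rightarrow> enat" where
  "distinguishing_number G =
     Inf {enat k | k. \<exists>c :: 'a \<Rightarrow> nat. c ` verts G \<subseteq> {..<k} \<and> distinguishing G c}"

text \<open>Meaningful as a distance only for vertices of the same component.\<close>

definition graph_dist :: "'a graph \<Rightarrow> 'a \<Rightarrow> 'a \<Rightarrow> nat" where
  "graph_dist G u v = (LEAST n. (u, v) \<in> edges G ^^ n)"

definition is_cycle :: "'a graph \<Rightarrow> 'a list \<Rightarrow> bool" where
  "is_cycle G p \<longleftrightarrow>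
     3 \<le> length p \<and> distinct p \<and>
     (\<forall>i. Suc i < length p \<longrightarrow> (p ! i, p ! Suc i) \<in> edges G) \<and>
     (last p, hd p) \<in> edges G"

definition is_tree :: "'a graph \<Rightarrow> bool" where
  "is_tree G \<longleftrightarrow> simple_graph G \<and> connected_graph G \<and> (\<nexists>p. is_cycle G p)"

text \<open>For \<open>n \<ge> 1\<close> this property determines the graph \<open>T\<^sub>n\<close> up to isomorphism (the
  root itself has valence 3, because a root of valence 1 would be a leaf at distance 0).\<close>

definition is_T :: "nat \<Rightarrow> 'a graph \<Rightarrow> bool" where
  "is_T n T \<longleftrightarrow>
     is_tree T \<and> finite (verts T) \<and>
     (\<forall>v\<in>verts T. valence T v = 1 \<or> valence T v = 3) \<and>
     (\<exists>r\<in>verts T. \<forall>v\<in>verts T. valence T v = 1 \<longrightarrow> graph_dist T r v = n)"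

end

theory Submission imports Defs begin

text \<open>Layer the graph by distance from a leaf \<open>v\<close> and call two vertices twins if they have the same
  level and the same parents; at most two vertices are mutual twins. A 2-coloring that separates
  all twins is preserved by no nontrivial automorphism fixing \<open>v\<close>. Color a geodesic chain from
  \<open>v\<close> black, one vertex of each pair of twins black (the one on the chain if there is one), and
  everything else white. A black path starting at a leaf off the chain can only climb towards the
  level of \<open>v\<close> without meeting the chain, so it is shorter than the chain, provided the chain is
  an infinite ray or ends at a vertex \<open>u\<close> farthest from \<open>v\<close>. Hence an automorphism
  preserving the coloring fixes \<open>v\<close> or sends it to \<open>u\<close>. The second case is excluded by
  the choice of \<open>u\<close> and of its color if no other leaf has the same neighbor as \<open>v\<close>.

  In the remaining finite graphs every leaf shares its neighbor with another leaf. Unless the graph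
  is a star, remove all leaves and induct: a distinguishing coloring extends by giving the two leaves
  at each vertex different colors, and \<open>T\<^sub>n\<close> becomes \<open>T\<^bsub>n+1\<^esub>\<close>.\<close>

section \<open>Automorphisms and distances\<close>

lemma edges_verts:
  assumes "simple_graph G" "(x, y) \<in> edges G"
  shows "x \<in> verts G" "y \<in> verts G"
  using assms by (auto simp: simple_graph_def)

lemma edges_sym: "simple_graph G \<Longrightarrow> (x, y) \<in> edges G \<Longrightarrow> (y, x) \<in> edges G"
  by (auto simp: simple_graph_def dest: symD)

lemma graph_iso_in: "graph_iso G H f \<Longrightarrow> x \<in> verts G \<Longrightarrow> f x \<in> verts H"
  by (auto simp: graph_iso_def bij_betw_def)

lemma graph_iso_eq_iff:
  "graph_iso G H f \<Longrightarrow> x \<in> verts G \<Longrightarrow> y \<in> verts G \<Longrightarrow> f x = f y \<longleftrightarrow> x = y"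
  by (auto simp: graph_iso_def bij_betw_def inj_on_eq_iff)

lemma graph_iso_onto:
  assumes "graph_iso G H f" "y \<in> verts H"
  obtains x where "x \<in> verts G" "f x = y"
proof -
  have "y \<in> f ` verts G"
    using assms by (simp add: graph_iso_def bij_betw_def)
  then show ?thesis
    using that by blast
qed

lemma graph_iso_inv:
  assumes "graph_iso G H f"
  shows "graph_iso H G (inv_into (verts G) f)"
proof -
  have bij: "bij_betw f (verts G) (verts H)"
    using assms by (simp add: graph_iso_def)
  have "(x, y) \<in> edges H \<longleftrightarrow> (inv_into (verts G) f x, inv_into (verts G) f y) \<in> edges G"
    if "x \<in> verts H" "y \<in> verts H" for x y
    using assms that bij_betw_inv_into_right[OF bij] bij_betw_apply[OF bij_betw_inv_into[OF bij]]
    by (metis graph_iso_def)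
  then show ?thesis
    using bij_betw_inv_into[OF bij] by (simp add: graph_iso_def)
qed

lemma graph_iso_neighbors:
  assumes "simple_graph G" "graph_iso G G f" "x \<in> verts G"
  shows "neighbors G (f x) = f ` neighbors G x"
proof
  show "neighbors G (f x) \<subseteq> f ` neighbors G x"
  proof
    fix y assume y: "y \<in> neighbors G (f x)"
    then have "y \<in> verts G"
      using assms(1) by (auto simp: neighbors_def dest: edges_verts)
    then obtain z where "z \<in> verts G" "f z = y"
      using graph_iso_onto[OF assms(2)] by blast
    then show "y \<in> f ` neighbors G x"
      using y assms by (auto simp: neighbors_def graph_iso_def)
  qed
  show "f ` neighbors G x \<subseteq> neighbors G (f x)"
    using assms by (auto simp: neighbors_def graph_iso_def dest: edges_verts)
qed

lemma graph_iso_valence: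
  assumes "simple_graph G" "graph_iso G G f" "x \<in> verts G"
  shows "valence G (f x) = valence G x"
proof -
  have "neighbors G x \<subseteq> verts G"
    using assms(1) by (auto simp: neighbors_def dest: edges_verts)
  then have "inj_on f (neighbors G x)"
    using assms(2) by (auto simp: graph_iso_def bij_betw_def intro: inj_on_subset)
  then show ?thesis
    by (simp add: valence_def graph_iso_neighbors[OF assms] card_image)
qed

lemma graph_iso_relpow:
  assumes "simple_graph G" "graph_iso G G f" "x \<in> verts G" "(x, y) \<in> edges G ^^ n"
  shows "(f x, f y) \<in> edges G ^^ n"
  using assms(4)
proof (induction n arbitrary: y)
  case (Suc n)
  then obtain z where z: "(x, z) \<in> edges G ^^ n" "(z, y) \<in> edges G"
    by auto
  then have "(f z, f y) \<in> edges G"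
    using assms(1,2) by (auto simp: graph_iso_def dest: edges_verts)
  then show ?case
    using Suc.IH[OF z(1)] by auto
qed simp

lemma graph_dist_relpow:
  assumes "connected_graph G" "x \<in> verts G" "y \<in> verts G"
  shows "(x, y) \<in> edges G ^^ graph_dist G x y"
  unfolding graph_dist_def
proof (rule LeastI_ex)
  show "\<exists>n. (x, y) \<in> edges G ^^ n"
    using assms by (auto simp: connected_graph_def rtrancl_power)
qed

lemma graph_dist_le: "(x, y) \<in> edges G ^^ n \<Longrightarrow> graph_dist G x y \<le> n"
  unfolding graph_dist_def by (rule Least_le)

lemma graph_dist_eq_0:
  assumes "connected_graph G" "x \<in> verts G" "y \<in> verts G"
  shows "graph_dist G x y = 0 \<longleftrightarrow> x = y"
  using graph_dist_relpow[OF assms] graph_dist_le[of x y 0 G] by auto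

lemma graph_dist_edge_le:
  assumes "connected_graph G" "x \<in> verts G" "y \<in> verts G" "(y, z) \<in> edges G"
  shows "graph_dist G x z \<le> Suc (graph_dist G x y)"
  using graph_dist_relpow[OF assms(1-3)] assms(4) by (intro graph_dist_le) auto

lemma graph_iso_dist_le:
  assumes "simple_graph G" "connected_graph G" "graph_iso G G f" "x \<in> verts G" "y \<in> verts G"
  shows "graph_dist G (f x) (f y) \<le> graph_dist G x y"
  using graph_iso_relpow[OF assms(1,3,4) graph_dist_relpow[OF assms(2,4,5)]]
  by (rule graph_dist_le)

lemma graph_iso_dist:
  assumes "simple_graph G" "connected_graph G" "graph_iso G G f" "x \<in> verts G" "y \<in> verts G"
  shows "graph_dist G (f x) (f y) = graph_dist G x y"
proof (rule antisym)
  have bij: "bij_betw f (verts G) (verts G)"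
    using assms(3) by (simp add: graph_iso_def)
  have "graph_dist G (inv_into (verts G) f (f x)) (inv_into (verts G) f (f y))
      \<le> graph_dist G (f x) (f y)"
    using assms graph_iso_in[OF assms(3)]
    by (intro graph_iso_dist_le graph_iso_inv) auto
  then show "graph_dist G x y \<le> graph_dist G (f x) (f y)"
    using bij_betw_inv_into_left[OF bij] assms(4,5) by simp
qed (rule graph_iso_dist_le[OF assms])

lemma distinguishingI:
  assumes "\<And>f x. graph_iso G G f \<Longrightarrow> (\<And>y. y \<in> verts G \<Longrightarrow> c (f y) = c y) \<Longrightarrow> x \<in> verts G \<Longrightarrow> f x = x"
  shows "distinguishing G c"
  using assms unfolding distinguishing_def by simp

section \<open>Layers around a leaf\<close>

text \<open>The bound 3 need not be attained, so the locale also covers the graphs that arise when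
  leaves are removed.\<close>

locale subcubic =
  fixes G :: "'a graph"
  assumes simple: "simple_graph G"
    and conn: "connected_graph G"
    and fin: "x \<in> verts G \<Longrightarrow> finite (neighbors G x)"
    and val3: "x \<in> verts G \<Longrightarrow> valence G x \<le> 3"
begin

lemma neighbors_verts: "y \<in> neighbors G x \<Longrightarrow> x \<in> verts G \<and> y \<in> verts G"
  using edges_verts[OF simple] by (auto simp: neighbors_def)

lemma neighbors_sym: "y \<in> neighbors G x \<Longrightarrow> x \<in> neighbors G y"
  using edges_sym[OF simple] by (auto simp: neighbors_def)

lemma neighbors_le_3:
  assumes "S \<subseteq> neighbors G x" "x \<in> verts G"
  shows "finite S" "card S \<le> 3"
  using assms finite_subset[OF assms(1) fin] card_mono[OF fin assms(1)] val3[of x]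
  by (auto simp: valence_def)

lemma leaf_unique_neighbor:
  "valence G x = 1 \<Longrightarrow> y \<in> neighbors G x \<Longrightarrow> z \<in> neighbors G x \<Longrightarrow> y = z"
  unfolding valence_def by (metis One_nat_def card_1_singleton_iff singletonD)

end

locale rooted_at_leaf = subcubic +
  fixes v :: 'a
  assumes v: "v \<in> verts G"
    and leaf: "valence G v = 1"
begin

definition lev :: "'a \<Rightarrow> nat" where
  "lev x = graph_dist G v x"

text \<open>The graph need not be a tree: a vertex may have several parents, and a neighbor on its
  own level is neither parent nor child.\<close>

definition parents :: "'a \<Rightarrow> 'a set" where
  "parents x = {y \<in> neighbors G x. lev x = Suc (lev y)}"

definition children :: "'a \<Rightarrow> 'a set" where
  "children x = {y \<in> neighbors G x. lev y = Suc (lev x)}"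

text \<open>An automorphism that fixes \<open>v\<close> and all lower levels can move a vertex only
  to one of its twins.\<close>

definition twin :: "'a \<Rightarrow> 'a \<Rightarrow> bool" where
  "twin x y \<longleftrightarrow> x \<in> verts G \<and> y \<in> verts G \<and> x \<noteq> y \<and> lev x = lev y \<and> parents x = parents y"

lemma lev_eq_0: "x \<in> verts G \<Longrightarrow> lev x = 0 \<longleftrightarrow> x = v"
  using graph_dist_eq_0[OF conn v] by (auto simp: lev_def)

lemma lev_v [simp]: "lev v = 0"
  using v lev_eq_0 by simp

lemma lev_edge: "(x, y) \<in> edges G \<Longrightarrow> lev y \<le> Suc (lev x)"
  unfolding lev_def using graph_dist_edge_le[OF conn v] edges_verts[OF simple] by blast

lemma children_iff_parents: "y \<in> children x \<longleftrightarrow> x \<in> parents y"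
  by (auto simp: children_def parents_def intro: neighbors_sym)

text \<open>The last vertex but one on a shortest walk from \<open>v\<close> is a parent, because
  the level grows by at most one along an edge.\<close>

lemma parents_nonempty:
  assumes "x \<in> verts G" "x \<noteq> v"
  shows "parents x \<noteq> {}"
proof -
  obtain n where n: "lev x = Suc n"
    using assms lev_eq_0 by (cases "lev x") auto
  have "(v, x) \<in> edges G ^^ Suc n"
    using graph_dist_relpow[OF conn v assms(1)] n by (simp add: lev_def)
  then obtain y where y: "(v, y) \<in> edges G ^^ n" "(y, x) \<in> edges G"
    by auto
  have "lev y \<le> n"
    using graph_dist_le[OF y(1)] by (simp add: lev_def)
  moreover have "lev x \<le> Suc (lev y)"
    using lev_edge[OF y(2)] .
  ultimately show ?thesis
    using n y(2) edges_sym[OF simple] by (auto simp: parents_def neighbors_def)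
qed

text \<open>The root has a single neighbor, being a leaf; every other vertex uses at least one of
  its at most three edges for a parent.\<close>

lemma children_at_most_two:
  assumes "{a, b, c} \<subseteq> children x"
  shows "a = b \<or> a = c \<or> b = c"
proof (rule ccontr)
  assume *: "\<not> ?thesis"
  have n: "{a, b, c} \<subseteq> neighbors G x"
    using assms by (auto simp: children_def)
  then have x: "x \<in> verts G"
    using neighbors_verts by blast
  have "x \<noteq> v"
    using * n leaf_unique_neighbor[OF leaf] by blast
  then obtain p where p: "p \<in> parents x"
    using parents_nonempty x by blast
  then have "{p, a, b, c} \<subseteq> neighbors G x" "p \<notin> {a, b, c}"
    using n assms by (auto simp: parents_def children_def)
  then show False
    using neighbors_le_3[of "{p, a, b, c}" x] x * by auto
qed

lemma twin_sym: "twin x y \<longleftrightarrow> twin y x"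
  by (auto simp: twin_def)

lemma twin_common_parent:
  assumes "twin x y"
  obtains p where "{x, y} \<subseteq> children p"
proof -
  have "x \<noteq> v"
    using assms lev_eq_0 by (metis lev_v twin_def)
  then obtain p where "p \<in> parents x"
    using assms parents_nonempty by (auto simp: twin_def)
  then show ?thesis
    using assms that by (auto simp: children_iff_parents twin_def)
qed

text \<open>A vertex and two different twins of it would be three children of a common
  parent.\<close>

lemma twin_unique:
  assumes "twin x y" "twin x z"
  shows "y = z"
proof -
  obtain p where "{x, y} \<subseteq> children p"
    using twin_common_parent[OF assms(1)] .
  then have "{x, y, z} \<subseteq> children p"
    using assms by (auto simp: children_iff_parents twin_def)
  then show ?thesis
    using children_at_most_two assms by (auto simp: twin_def)
qed

text \<open>By induction on the level all parents of \<open>x\<close> are fixed, so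
  \<open>f x\<close> has the level and the parents of \<open>x\<close>. It is then \<open>x\<close>
  or a twin of \<open>x\<close>, and twins differ in color.\<close>

lemma fixes_all:
  assumes f: "graph_iso G G f" and fv: "f v = v"
    and col: "\<And>x. x \<in> verts G \<Longrightarrow> f x \<in> B \<longleftrightarrow> x \<in> B"
    and tw: "\<And>x y. twin x y \<Longrightarrow> x \<in> B \<longleftrightarrow> y \<notin> B"
    and x: "x \<in> verts G"
  shows "f x = x"
  using x
proof (induction "lev x" arbitrary: x rule: less_induct)
  case less
  have lev_f: "lev (f y) = lev y" if "y \<in> verts G" for y
    using graph_iso_dist[OF simple conn f v that] fv by (simp add: lev_def)
  have "parents (f x) = f ` parents x"
    unfolding parents_def graph_iso_neighbors[OF simple f less.prems]
    using lev_f less.prems neighbors_verts by auto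
  also have "\<dots> = parents x"
    using less.hyps neighbors_verts by (force simp: parents_def)
  finally have "f x \<noteq> x \<Longrightarrow> twin x (f x)"
    using lev_f less.prems graph_iso_in[OF f] by (simp add: twin_def)
  then show ?case
    using tw col less.prems by blast
qed

section \<open>Colorings that separate twins\<close>

text \<open>\<open>R\<close> stands for a chain; having at most one vertex per level, it contains at
  most one of two twins, so its vertices can be preferred. \<open>S\<close> is the part of the chain
  that is black in any case; the rest of the chain is black only where there is a twin.\<close>

lemma twin_transversal:
  assumes R: "\<And>x y. x \<in> R \<Longrightarrow> y \<in> R \<Longrightarrow> lev x = lev y \<Longrightarrow> x = y" and "S \<subseteq> R"
  obtains B where
    "\<And>x y. twin x y \<Longrightarrow> x \<in> B \<longleftrightarrow> y \<notin> B"
    "\<And>x. x \<in> B \<Longrightarrow> x \<notin> R \<Longrightarrow> \<exists>y. twin x y"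
    "\<And>x y. x \<in> R \<Longrightarrow> twin x y \<Longrightarrow> x \<in> B"
    "S \<subseteq> B"
    "\<And>x. x \<in> R \<Longrightarrow> x \<notin> S \<Longrightarrow> (\<And>y. \<not> twin x y) \<Longrightarrow> x \<notin> B"
proof -
  \<comment> \<open>The choice is made from the unordered pair, so both twins agree on which of them
    is picked.\<close>
  define pick where "pick x y = (SOME z. z \<in> {x, y})" for x y :: 'a
  have pick: "pick x y \<in> {x, y}" "pick x y = pick y x" for x y
    unfolding pick_def by (rule someI[of _ x], simp) (simp add: insert_commute)
  define B where "B = S \<union> {x. \<exists>y. twin x y \<and> (x \<in> R \<or> y \<notin> R \<and> pick x y = x)}"
  \<comment> \<open>Since twins are unique, the twin quantified in \<open>B\<close> is the given
    \<open>y\<close>.\<close>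
  have B_iff: "x \<in> B \<longleftrightarrow> x \<in> R \<or> y \<notin> R \<and> pick x y = x" if "twin x y" for x y
    unfolding B_def using that twin_unique \<open>S \<subseteq> R\<close> by blast
  show ?thesis
  proof
    fix x y assume xy: "twin x y"
    have "\<not> (x \<in> R \<and> y \<in> R)"
      using R xy by (auto simp: twin_def)
    then show "x \<in> B \<longleftrightarrow> y \<notin> B"
      using B_iff[OF xy] B_iff[of y x] xy pick[of x y] twin_sym[of x y]
      by (auto simp: twin_def)
  qed (use B_iff \<open>S \<subseteq> R\<close> in \<open>auto simp: B_def\<close>)
qed

text \<open>A parent \<open>p\<close> on the chain has a child \<open>z\<close> on the chain,
  besides \<open>x\<close> and its twin \<open>y\<close>. Since \<open>p\<close> has at most two
  children, \<open>z\<close> is \<open>y\<close>; but then \<open>y\<close> is black like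
  \<open>x\<close>, although twins differ.\<close>

lemma parents_off_chain:
  assumes ext: "\<And>x. x \<in> R \<Longrightarrow> children x \<noteq> {} \<Longrightarrow> children x \<inter> R \<noteq> {}"
    and tw: "\<And>x y. twin x y \<Longrightarrow> x \<in> B \<longleftrightarrow> y \<notin> B"
    and off: "\<And>x. x \<in> B \<Longrightarrow> x \<notin> R \<Longrightarrow> \<exists>y. twin x y"
    and RB: "\<And>x y. x \<in> R \<Longrightarrow> twin x y \<Longrightarrow> x \<in> B"
    and x: "x \<in> B" "x \<notin> R" and p: "p \<in> parents x"
  shows "p \<notin> R"
proof
  assume "p \<in> R"
  then obtain z where z: "z \<in> children p" "z \<in> R"
    using ext p by (auto simp flip: children_iff_parents)
  obtain y where y: "twin x y"
    using off x by blast
  have "{x, y, z} \<subseteq> children p"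
    using y z p by (auto simp: children_iff_parents twin_def)
  then have "z = y"
    using children_at_most_two z x y by (auto simp: twin_def)
  then show False
    using RB[of y x] tw[OF y] y z x by (auto simp: twin_sym)
qed

text \<open>A black vertex off the chain has a white twin with the same parents. A parent reached from it
  by the path therefore has two of its three edges leading down to that pair, and the only
  black continuation is the third edge, which leads up.\<close>

lemma black_path_climbs:
  assumes ext: "\<And>x. x \<in> R \<Longrightarrow> children x \<noteq> {} \<Longrightarrow> children x \<inter> R \<noteq> {}"
    and tw: "\<And>x y. twin x y \<Longrightarrow> x \<in> B \<longleftrightarrow> y \<notin> B"
    and off: "\<And>x. x \<in> B \<Longrightarrow> x \<notin> R \<Longrightarrow> \<exists>y. twin x y"
    and RB: "\<And>x y. x \<in> R \<Longrightarrow> twin x y \<Longrightarrow> x \<in> B"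
    and vR: "v \<in> R"
    and edge: "\<And>i. i < m \<Longrightarrow> p (Suc i) \<in> neighbors G (p i)"
    and nonbt: "\<And>i. Suc i < m \<Longrightarrow> p (Suc (Suc i)) \<noteq> p i"
    and black: "\<And>i. i \<le> m \<Longrightarrow> p i \<in> B"
    and start: "p 0 \<notin> R" "p 0 \<in> verts G" "valence G (p 0) = 1"
  shows "i \<le> m \<Longrightarrow> p i \<notin> R \<and> lev (p i) + i = lev (p 0)"
proof -
  have noR: "q \<notin> R" if "x \<in> B" "x \<notin> R" "q \<in> parents x" for x q
    using parents_off_chain[of R B x q] ext tw off RB that by blast
  \<comment> \<open>The induction also records that the next vertex is a parent, so that the twin of
    \<open>p i\<close> is a child of it as well.\<close>
  have step: "i < m \<Longrightarrow> p i \<notin> R \<and> p (Suc i) \<notin> R \<and> p (Suc i) \<in> parents (p i)" for i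
  proof (induction i)
    case 0
    have "p 0 \<noteq> v"
      using start vR by blast
    then obtain q where q: "q \<in> parents (p 0)"
      using parents_nonempty start by blast
    then have "q = p 1"
      using leaf_unique_neighbor[OF start(3)] edge[OF 0] by (auto simp: parents_def)
    then show ?case
      using q noR[of "p 0"] black[of 0] start by auto
  next
    case (Suc i)
    let ?x = "p (Suc i)" and ?y = "p (Suc (Suc i))"
    have IH: "p i \<notin> R" "?x \<notin> R" "?x \<in> parents (p i)"
      using Suc by auto
    obtain t where t: "twin (p i) t"
      using off black[of i] IH Suc.prems by auto
    have t_white: "t \<notin> B"
      using tw[OF t] black[of i] Suc.prems by auto
    have ch: "p i \<in> children ?x" "t \<in> children ?x"
      using IH t by (auto simp: children_iff_parents twin_def)
    have x: "?x \<in> verts G" "?x \<noteq> v"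
      using IH neighbors_verts vR by (auto simp: parents_def)
    have "?y \<in> parents ?x"
    proof (rule ccontr)
      assume y: "?y \<notin> parents ?x"
      obtain q where q: "q \<in> parents ?x"
        using parents_nonempty x by blast
      \<comment> \<open>These would be four distinct neighbors: \<open>q\<close> is a parent,
        whereas \<open>p i\<close> and \<open>t\<close> are children and \<open>?y\<close> is no
        parent by assumption; \<open>t\<close> is white and \<open>?y\<close> black; and the path
        does not backtrack to \<open>p i\<close>.\<close>
      have "{q, p i, t, ?y} \<subseteq> neighbors G ?x"
        using q ch edge[OF Suc.prems] by (auto simp: children_def parents_def)
      then have "card {q, p i, t, ?y} \<le> 3"
        using neighbors_le_3 x by blast
      moreover have "q \<noteq> p i" "q \<noteq> t" "q \<noteq> ?y" "p i \<noteq> t" "p i \<noteq> ?y" "t \<noteq> ?y"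
        using q ch y t t_white black[of "Suc (Suc i)"] nonbt[OF Suc.prems] Suc.prems
        by (auto simp: children_def parents_def twin_def)
      ultimately show False
        by simp
    qed
    then show ?case
      using noR[of ?x] black[of "Suc i"] IH Suc.prems by auto
  qed
  show "i \<le> m \<Longrightarrow> p i \<notin> R \<and> lev (p i) + i = lev (p 0)"
  proof (induction i)
    case (Suc i)
    then show ?case
      using step[of i] by (auto simp: parents_def)
  qed (use start in simp)
qed

section \<open>Chains descending from the root\<close>

lemma descendants: "x \<in> verts G \<Longrightarrow> (v, x) \<in> {(a, b). b \<in> children a} ^^ lev x"
proof (induction "lev x" arbitrary: x)
  case 0
  then show ?case
    using lev_eq_0 by auto
next
  case (Suc n)
  then have "x \<noteq> v"
    using Suc.hyps(2) by auto
  then obtain p where p: "p \<in> parents x"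
    using parents_nonempty Suc.prems by blast
  then have "lev p = n" "p \<in> verts G"
    using Suc.hyps(2) neighbors_verts by (auto simp: parents_def)
  then have "(v, p) \<in> {(a, b). b \<in> children a} ^^ n"
    using Suc.hyps(1) by blast
  then show ?case
    using p Suc.hyps(2)[symmetric] by (auto simp: children_iff_parents)
qed

text \<open>This is Koenig's lemma for the relation from parent to child: a vertex with infinitely
  many descendants has only finitely many children, so one of these has infinitely many descendants
  too.\<close>

lemma infinite_ray:
  assumes "infinite (verts G)"
  obtains r where "r 0 = v" "\<And>i. r (Suc i) \<in> children (r i)"
proof -
  let ?C = "{(a, b). b \<in> children a}"
  define D where "D x = {y. (x, y) \<in> ?C\<^sup>*}" for x
  have step: "\<exists>y. y \<in> children x \<and> infinite (D y)" if "infinite (D x)" for x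
  proof (rule ccontr)
    assume *: "\<not> ?thesis"
    have "D x \<subseteq> insert x (\<Union>y\<in>children x. D y)"
      unfolding D_def by (auto elim: converse_rtranclE)
    moreover have "finite (children x)"
      using fin[of x] neighbors_verts
      by (cases "x \<in> verts G") (auto simp: children_def intro: finite_subset[of _ "{}"])
    ultimately show False
      using * that by (meson finite_UN_I finite_insert finite_subset)
  qed
  have "verts G \<subseteq> D v"
    using descendants unfolding D_def by (auto intro: relpow_imp_rtrancl)
  then have "infinite (D v)"
    using assms finite_subset by blast
  then have "\<exists>r. \<forall>n. (infinite (D (r n)) \<and> (n = 0 \<longrightarrow> r n = v)) \<and> r (Suc n) \<in> children (r n)"
    using step by (intro dependent_nat_choice) auto
  then show ?thesis
    using that by blast
qed

lemma chain_lev: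
  assumes "r 0 = v" "\<And>i. i < n \<Longrightarrow> r (Suc i) \<in> children (r i)" "i \<le> n"
  shows "lev (r i) = i"
  using assms(3)
proof (induction i)
  case (Suc i)
  then show ?case
    using assms(2)[of i] by (simp add: children_def)
qed (simp add: assms(1))

lemma chain_inner_not_leaf:
  assumes "r (Suc i) \<in> children (r i)" "r (Suc (Suc i)) \<in> children (r (Suc i))"
  shows "valence G (r (Suc i)) \<noteq> 1"
proof
  assume "valence G (r (Suc i)) = 1"
  then have "r i = r (Suc (Suc i))"
    using assms by (auto simp: children_def intro: leaf_unique_neighbor neighbors_sym)
  then show False
    using assms by (auto simp: children_def)
qed

text \<open>Provides the edge and no-backtracking hypotheses of \<open>black_path_climbs\<close> for
  the path \<open>f (r i)\<close>. There is no backtracking because \<open>r i\<close> and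
  \<open>r (Suc (Suc i))\<close> lie on different levels and \<open>f\<close> is injective.\<close>

lemma image_of_chain:
  assumes f: "graph_iso G G f"
    and r: "r 0 = v" "\<And>i. i < n \<Longrightarrow> r (Suc i) \<in> children (r i)"
  shows "i \<le> n \<Longrightarrow> r i \<in> verts G"
    and "i < n \<Longrightarrow> f (r (Suc i)) \<in> neighbors G (f (r i))"
    and "Suc i < n \<Longrightarrow> f (r (Suc (Suc i))) \<noteq> f (r i)"
proof -
  have V: "r i \<in> verts G" if "i \<le> n" for i
  proof (cases i)
    case (Suc j)
    then show ?thesis
      using r(2)[of j] neighbors_verts that by (auto simp: children_def)
  qed (simp add: r v)
  then show "i \<le> n \<Longrightarrow> r i \<in> verts G" .
  show "i < n \<Longrightarrow> f (r (Suc i)) \<in> neighbors G (f (r i))"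
    using r(2)[of i] V[of i] graph_iso_neighbors[OF simple f] by (auto simp: children_def)
  show "f (r (Suc (Suc i))) \<noteq> f (r i)" if "Suc i < n"
    using graph_iso_eq_iff[OF f V[of "Suc (Suc i)"] V[of i]] that
      chain_lev[of r n i, OF r] chain_lev[of r n "Suc (Suc i)", OF r] by auto
qed

section \<open>Two-colorings of infinite and finite graphs\<close>

text \<open>If \<open>f v\<close> were off the ray, the image of the black ray would climb forever.
  On the ray, \<open>v\<close> is the only leaf.\<close>

lemma infinite_two_coloring:
  assumes "infinite (verts G)"
  shows "\<exists>B. distinguishing G (\<lambda>x. x \<in> B)"
proof -
  obtain r where r: "r 0 = v" "\<And>i. r (Suc i) \<in> children (r i)"
    using infinite_ray[OF assms] by blast
  have lev_r: "lev (r i) = i" for i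
    using chain_lev[of r i i] r by blast
  define R where "R = range r"
  have uniq: "x = y" if "x \<in> R" "y \<in> R" "lev x = lev y" for x y
    using that lev_r by (auto simp: R_def)
  obtain B where tw: "\<And>x y. twin x y \<Longrightarrow> x \<in> B \<longleftrightarrow> y \<notin> B"
    and off: "\<And>x. x \<in> B \<Longrightarrow> x \<notin> R \<Longrightarrow> \<exists>y. twin x y"
    and RB: "\<And>x y. x \<in> R \<Longrightarrow> twin x y \<Longrightarrow> x \<in> B" and "R \<subseteq> B"
  proof (rule twin_transversal[of R R, OF uniq subset_refl])
    fix B
    assume B: "\<And>x y. twin x y \<Longrightarrow> x \<in> B \<longleftrightarrow> y \<notin> B"
      "\<And>x. x \<in> B \<Longrightarrow> x \<notin> R \<Longrightarrow> \<exists>y. twin x y"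
      "\<And>x y. x \<in> R \<Longrightarrow> twin x y \<Longrightarrow> x \<in> B" "R \<subseteq> B"
    show thesis
      using that[OF B] .
  qed
  have "distinguishing G (\<lambda>x. x \<in> B)"
  proof (rule distinguishingI)
    fix f x
    assume f: "graph_iso G G f" and col: "\<And>x. x \<in> verts G \<Longrightarrow> f x \<in> B \<longleftrightarrow> x \<in> B"
      and x: "x \<in> verts G"
    \<comment> \<open>One step more than a climb from \<open>f v\<close> can have.\<close>
    let ?m = "Suc (lev (f v))"
    have fv: "f v \<in> verts G" "valence G (f v) = 1"
      using graph_iso_in[OF f v] graph_iso_valence[OF simple f v] leaf by auto
    note path = image_of_chain[of f r ?m, OF f r(1) r(2)]
    have "f v \<in> R"
    proof (rule ccontr)
      assume "f v \<notin> R"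
      have "f (r ?m) \<notin> R \<and> lev (f (r ?m)) + ?m = lev (f (r 0))"
      proof (rule black_path_climbs[of R B ?m "\<lambda>i. f (r i)" ?m])
        show "f (r i) \<in> B" if "i \<le> ?m" for i
          using col[OF path(1)[OF that]] \<open>R \<subseteq> B\<close> by (auto simp: R_def)
        show "f (r 0) \<notin> R" "f (r 0) \<in> verts G" "valence G (f (r 0)) = 1"
          using \<open>f v \<notin> R\<close> fv r(1) by auto
        show "v \<in> R" "\<And>x. x \<in> R \<Longrightarrow> children x \<noteq> {} \<Longrightarrow> children x \<inter> R \<noteq> {}"
          using r by (auto simp: R_def)
      qed (fact tw off RB path order_refl)+
      then show False
        using r(1) by simp
    qed
    then obtain i where i: "f v = r i"
      by (auto simp: R_def)
    have "i = 0"
      using chain_inner_not_leaf[of r "i - 1"] r(2) fv i by (cases i) auto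
    then have "f v = v"
      using i r by simp
    then show "f x = x"
      using fixes_all[OF f _ col tw x] by blast
  qed
  then show ?thesis
    by blast
qed

text \<open>The chain now ends at a deepest vertex \<open>u\<close>, so \<open>f v\<close> may be
  either end of it. The assumption \<open>unpaired\<close> serves to exclude
  \<open>u\<close>.\<close>

lemma finite_two_coloring:
  assumes finite: "finite (verts G)"
    and unpaired: "\<And>w. w \<in> verts G \<Longrightarrow> w \<noteq> v \<Longrightarrow> valence G w = 1 \<Longrightarrow> neighbors G w \<noteq> neighbors G v"
  shows "\<exists>B. distinguishing G (\<lambda>x. x \<in> B)"
proof -
  define n where "n = Max (lev ` verts G)"
  have lev_le: "lev x \<le> n" if "x \<in> verts G" for x
    using that finite by (simp add: n_def)
  have "n \<in> lev ` verts G"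
    unfolding n_def using finite v by (intro Max_in) auto
  then obtain u where u: "u \<in> verts G" "lev u = n"
    and u_nonleaf: "(\<exists>x\<in>verts G. lev x = n \<and> valence G x \<noteq> 1) \<Longrightarrow> valence G u \<noteq> 1"
    by blast
  obtain w where w: "w \<in> neighbors G v"
    using leaf by (force simp: valence_def)
  have "lev w \<noteq> 0"
    using w neighbors_verts lev_eq_0 simple by (auto simp: simple_graph_def neighbors_def irrefl_def)
  then have n: "0 < n"
    using lev_le[of w] w neighbors_verts by fastforce
  \<comment> \<open>By the choice of \<open>u\<close>, if it is a leaf then so is its twin, being at maximal level too.\<close>
  obtain r where r: "r 0 = v" "r n = u" "\<And>i. i < n \<Longrightarrow> r (Suc i) \<in> children (r i)"
    using descendants[OF u(1)] unfolding u(2) relpow_fun_conv by auto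
  have lev_r: "lev (r i) = i" if "i \<le> n" for i
    using chain_lev[of r n i] r that by blast
  define R where "R = r ` {..n}"
  have uR: "u \<in> R"
    using r(2) by (auto simp: R_def)
  have uniq: "x = y" if "x \<in> R" "y \<in> R" "lev x = lev y" for x y
    using that lev_r by (auto simp: R_def)
  obtain B where tw: "\<And>x y. twin x y \<Longrightarrow> x \<in> B \<longleftrightarrow> y \<notin> B"
    and off: "\<And>x. x \<in> B \<Longrightarrow> x \<notin> R \<Longrightarrow> \<exists>y. twin x y"
    and RB: "\<And>x y. x \<in> R \<Longrightarrow> twin x y \<Longrightarrow> x \<in> B" and B: "R - {u} \<subseteq> B"
    and uB: "(\<And>y. \<not> twin u y) \<Longrightarrow> u \<notin> B"
  \<comment> \<open>Leaving \<open>u\<close> out of \<open>S\<close> makes it black exactly if it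
    has a twin.\<close>
  proof (rule twin_transversal[of R "R - {u}", OF uniq Diff_subset])
    fix B
    assume B: "\<And>x y. twin x y \<Longrightarrow> x \<in> B \<longleftrightarrow> y \<notin> B"
      "\<And>x. x \<in> B \<Longrightarrow> x \<notin> R \<Longrightarrow> \<exists>y. twin x y"
      "\<And>x y. x \<in> R \<Longrightarrow> twin x y \<Longrightarrow> x \<in> B" "R - {u} \<subseteq> B"
      "\<And>x. x \<in> R \<Longrightarrow> x \<notin> R - {u} \<Longrightarrow> (\<And>y. \<not> twin x y) \<Longrightarrow> x \<notin> B"
    show thesis
      using that[OF B(1-4)] B(5)[OF uR] by simp
  qed
  \<comment> \<open>The chain stops only at \<open>u\<close>, which has no children because its
    level is maximal.\<close>
  have ext: "children x \<inter> R \<noteq> {}" if x: "x \<in> R" "children x \<noteq> {}" for x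
  proof -
    obtain i where i: "i \<le> n" "x = r i"
      using x by (auto simp: R_def)
    obtain y where "y \<in> children x"
      using x by blast
    then have "i < n"
      using lev_r[OF i(1)] lev_le[of y] neighbors_verts i by (fastforce simp: children_def)
    then show ?thesis
      using r(3)[of i] i by (auto simp: R_def)
  qed
  \<comment> \<open>As \<open>v\<close> has one neighbor, levels 0 and 1 consist of
    \<open>r 0\<close> and \<open>r 1\<close> alone.\<close>
  have near: "x \<in> R" if x: "x \<in> verts G" "lev x \<le> 1" for x
  proof (cases "x = v")
    case False
    then obtain p where p: "p \<in> parents x"
      using parents_nonempty x by blast
    then have "p = v"
      using lev_eq_0[of p] neighbors_verts x(2) by (auto simp: parents_def)
    then have "x = r 1"
      using leaf_unique_neighbor[OF leaf] p r(1) r(3)[OF n] neighbors_sym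
      by (auto simp: parents_def children_def)
    then show ?thesis
      using n by (auto simp: R_def)
  qed (use r(1) in \<open>force simp: R_def\<close>)
  have "distinguishing G (\<lambda>x. x \<in> B)"
  proof (rule distinguishingI)
    fix f x
    assume f: "graph_iso G G f" and col: "\<And>x. x \<in> verts G \<Longrightarrow> f x \<in> B \<longleftrightarrow> x \<in> B"
      and x: "x \<in> verts G"
    have fv: "f v \<in> verts G" "valence G (f v) = 1"
      using graph_iso_in[OF f v] graph_iso_valence[OF simple f v] leaf by auto
    note path = image_of_chain[of f r n, OF f r(1) r(3)]
    have r_ne_u: "r i \<noteq> u" if "i < n" for i
      using lev_r[of i] u(2) that by auto
    have "f v \<in> R"
    proof (rule ccontr)
      assume "f v \<notin> R"
      \<comment> \<open>The last vertex \<open>u\<close> may be white, so only \<open>n - 1\<close>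
        steps are available. Starting at level at most \<open>n\<close>, they still lead up to level
        at most 1, which lies on the chain.\<close>
      have black: "f (r i) \<in> B" if "i \<le> n - 1" for i
      proof -
        have "i < n"
          using that n by simp
        then have "r i \<in> R - {u}"
          using r_ne_u by (simp add: R_def)
        then show ?thesis
          using B col path(1)[of i] \<open>i < n\<close> by auto
      qed
      have "f (r (n - 1)) \<notin> R \<and> lev (f (r (n - 1))) + (n - 1) = lev (f (r 0))"
      proof (rule black_path_climbs[of R B "n - 1" "\<lambda>i. f (r i)" "n - 1"])
        show "f (r 0) \<notin> R" "f (r 0) \<in> verts G" "valence G (f (r 0)) = 1"
          using \<open>f v \<notin> R\<close> fv r(1) by auto
        show "v \<in> R"
          using near v by simp
        show "f (r (Suc i)) \<in> neighbors G (f (r i))" if "i < n - 1" for i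
          using path(2)[of i] that by simp
        show "f (r (Suc (Suc i))) \<noteq> f (r i)" if "Suc i < n - 1" for i
          using path(3)[of i] that by simp
      qed (fact tw off RB ext black order_refl)+
      moreover have "lev (f (r 0)) \<le> n"
        using lev_le fv r(1) by simp
      moreover have "f (r (n - 1)) \<in> verts G"
        using path(1)[of "n - 1"] graph_iso_in[OF f] by simp
      ultimately have "f (r (n - 1)) \<notin> R" "f (r (n - 1)) \<in> verts G" "lev (f (r (n - 1))) \<le> 1"
        using n by linarith+
      then show False
        using near by blast
    qed
    then obtain i where i: "i \<le> n" "f v = r i"
      by (auto simp: R_def)
    have "i = 0 \<or> i = n"
    proof (cases i)
      case (Suc j)
      have "\<not> Suc j < n"
      proof
        assume "Suc j < n"
        then show False
          using chain_inner_not_leaf[of r j, OF r(3) r(3)] fv i Suc by simp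
      qed
      then show ?thesis
        using Suc i by linarith
    qed simp
    moreover have "f v \<noteq> u"
    proof
      assume fvu: "f v = u"
      \<comment> \<open>Since \<open>v\<close> is black, so is \<open>u\<close>, which therefore has
        a twin \<open>t\<close>. Both are leaves at the same vertex, so the preimage of
        \<open>t\<close> is a leaf with the same neighbor as \<open>v\<close>.\<close>
      have "v \<in> B"
        using B r(1) r_ne_u[OF n] by (force simp: R_def)
      then obtain t where t: "twin u t"
        using uB col[OF v] fvu by blast
      then have tV: "t \<in> verts G" "t \<noteq> u" "lev t = n"
        using u by (auto simp: twin_def)
      then have t_leaf: "valence G t = 1"
        using u_nonleaf fvu fv(2) by auto
      obtain p where p: "{u, t} \<subseteq> children p"
        using twin_common_parent[OF t] .
      have nb: "neighbors G y = {p}" if "y \<in> children p" "valence G y = 1" for y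
        using leaf_unique_neighbor[OF that(2)] that(1) neighbors_sym by (auto simp: children_def)
      obtain s where s: "s \<in> verts G" "f s = t"
        using graph_iso_onto[OF f tV(1)] .
      have "f ` neighbors G s = f ` neighbors G v"
        using graph_iso_neighbors[OF simple f] s v fvu nb[of u] nb[of t] p t_leaf fv by auto
      moreover have "inj_on f (verts G)"
        using f by (simp add: graph_iso_def bij_betw_def)
      ultimately have "neighbors G s = neighbors G v"
        using neighbors_verts by (auto simp: inj_on_image_eq_iff subset_iff)
      then show False
        using unpaired[of s] s tV fvu graph_iso_valence[OF simple f s(1)] t_leaf by auto
    qed
    ultimately have "f v = v"
      using i r by auto
    then show "f x = x"
      using fixes_all[OF f _ col tw x] by blast
  qed
  then show ?thesis
    by blast
qed

end

section \<open>Removing all leaves\<close>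

lemma (in subcubic) cycle_vertex_not_leaf:
  assumes c: "is_cycle G p" and x: "x \<in> set p"
  shows "valence G x \<noteq> 1"
proof
  assume leaf: "valence G x = 1"
  have len: "3 \<le> length p" and d: "distinct p"
    and e: "\<And>i. Suc i < length p \<Longrightarrow> (p ! i, p ! Suc i) \<in> edges G"
    and "(last p, hd p) \<in> edges G" "p \<noteq> []"
    using c by (auto simp: is_cycle_def)
  then have l: "(p ! (length p - 1), p ! 0) \<in> edges G"
    by (simp add: last_conv_nth hd_conv_nth)
  have nb: "(a, b) \<in> edges G \<Longrightarrow> b \<in> neighbors G a \<and> a \<in> neighbors G b" for a b
    using edges_sym[OF simple] by (simp add: neighbors_def)
  obtain i where i: "i < length p" "x = p ! i"
    using x by (auto simp: in_set_conv_nth)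
  \<comment> \<open>The cyclic predecessor and successor of position \<open>i\<close>; they differ
    because the cycle has length at least 3.\<close>
  define j where "j = (if i = 0 then length p - 1 else i - 1)"
  define k where "k = (if i = length p - 1 then 0 else Suc i)"
  have "p ! j \<in> neighbors G x"
    using nb[OF l] nb[OF e[of "i - 1"]] i by (auto simp: j_def)
  moreover have "p ! k \<in> neighbors G x"
    using nb[OF l] nb[OF e[of i]] i by (auto simp: k_def)
  ultimately have "p ! j = p ! k"
    using leaf_unique_neighbor[OF leaf] by blast
  moreover have "j < length p" "k < length p" "j \<noteq> k"
    using len i by (auto simp: j_def k_def)
  ultimately show False
    using d by (simp add: nth_eq_iff_index_eq)
qed

text \<open>The case complementary to \<open>finite_two_coloring\<close>: no leaf satisfies the
  condition \<open>unpaired\<close> there.\<close>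

locale paired_leaves = subcubic +
  assumes finite_verts: "finite (verts G)"
    and paired: "\<And>w. w \<in> verts G \<Longrightarrow> valence G w = 1 \<Longrightarrow>
      \<exists>w'\<in>verts G. w' \<noteq> w \<and> valence G w' = 1 \<and> neighbors G w' = neighbors G w"
    and leaf_exists: "\<exists>w\<in>verts G. valence G w = 1"
begin

definition leaves_at :: "'a \<Rightarrow> 'a set" where
  "leaves_at p = {w \<in> neighbors G p. valence G w = 1}"

text \<open>All valences here are taken in \<open>G\<close>, so the core may have new
  leaves.\<close>

definition core :: "'a graph" where
  "core = \<lparr>verts = {x \<in> verts G. valence G x \<noteq> 1},
    edges = {(x, y) \<in> edges G. valence G x \<noteq> 1 \<and> valence G y \<noteq> 1}\<rparr>"

lemma verts_core: "x \<in> verts core \<longleftrightarrow> x \<in> verts G \<and> valence G x \<noteq> 1"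
  by (simp add: core_def)

lemma edges_core: "(x, y) \<in> edges core \<longleftrightarrow> (x, y) \<in> edges G \<and> valence G x \<noteq> 1 \<and> valence G y \<noteq> 1"
  by (simp add: core_def)

lemma neighbors_core: "x \<in> verts core \<Longrightarrow> neighbors core x = neighbors G x - leaves_at x"
  by (auto simp: neighbors_def edges_core verts_core leaves_at_def)

lemma simple_core: "simple_graph core"
  using simple by (auto simp: simple_graph_def core_def sym_def irrefl_def)

text \<open>The neighbor of a leaf is adjacent to a second leaf by pairing, hence is not a leaf
  itself.\<close>

lemma leaf_neighbor:
  assumes "w \<in> verts G" "valence G w = 1"
  obtains p where "neighbors G w = {p}" "p \<in> verts core"
proof -
  obtain p where p: "neighbors G w = {p}"
    using assms by (metis One_nat_def card_1_singleton_iff valence_def)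
  obtain w' where "w' \<noteq> w" "neighbors G w' = {p}"
    using paired[OF assms] p by auto
  then have "w \<in> neighbors G p" "w' \<in> neighbors G p" "w' \<noteq> w"
    using p neighbors_sym by blast+
  then have "valence G p \<noteq> 1"
    using leaf_unique_neighbor by blast
  then show ?thesis
    using p that neighbors_verts[of p w] by (auto simp: verts_core)
qed

lemma core_nonempty: "verts core \<noteq> {}"
  using leaf_exists leaf_neighbor by blast

text \<open>Pairing yields at least two leaves at \<open>p\<close>, and a neighbor that is not a
  leaf leaves room for no more than two.\<close>

lemma card_leaves_at:
  assumes p: "p \<in> verts core" "leaves_at p \<noteq> {}" and nb: "\<not> neighbors G p \<subseteq> leaves_at p"
  shows "card (leaves_at p) = 2" "valence G p = 3"
proof -
  obtain w where w: "w \<in> neighbors G p" "valence G w = 1"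
    using p by (auto simp: leaves_at_def)
  then obtain w' where w': "w' \<in> verts G" "w' \<noteq> w" "valence G w' = 1" "neighbors G w' = neighbors G w"
    using paired[of w] neighbors_verts by blast
  then have "w' \<in> neighbors G p"
    using w neighbors_sym by blast
  then have sub: "{w, w'} \<subseteq> leaves_at p"
    using w w' by (auto simp: leaves_at_def)
  have pV: "p \<in> verts G"
    using p by (simp add: verts_core)
  have "leaves_at p \<subset> neighbors G p"
    using nb by (auto simp: leaves_at_def)
  then have "card (leaves_at p) < valence G p" "finite (leaves_at p)"
    using fin[OF pV] by (auto simp: valence_def intro: psubset_card_mono finite_subset)
  moreover have "2 \<le> card (leaves_at p)"
    using card_mono[OF calculation(2) sub] w'(2) by simp
  ultimately show "card (leaves_at p) = 2" "valence G p = 3"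
    using val3[OF pV] by auto
qed

lemma relpow_core_subset: "(x, y) \<in> edges core ^^ n \<Longrightarrow> (x, y) \<in> edges G ^^ n"
proof (induction n arbitrary: y)
  case (Suc n)
  then show ?case
    by (force simp: edges_core)
qed simp

text \<open>A walk that enters a leaf must go back to where it came from, so such detours can be cut
  out. If the walk ends at a leaf, its final step is dropped; this gives the strict bound from which
  \<open>extend_T\<close> obtains exact distances.\<close>

lemma core_walk:
  assumes "x \<in> verts core" "(x, y) \<in> edges G ^^ n"
  shows "(y \<in> verts core \<and> (\<exists>m\<le>n. (x, y) \<in> edges core ^^ m)) \<or>
    (\<exists>m<n. \<exists>q. neighbors G y = {q} \<and> q \<in> verts core \<and> (x, q) \<in> edges core ^^ m)"
  using assms(2)
proof (induction n arbitrary: y)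
  case 0
  then show ?case
    using assms(1) by auto
next
  case (Suc n)
  then obtain z where z: "(x, z) \<in> edges G ^^ n" "(z, y) \<in> edges G"
    by auto
  have yV: "y \<in> verts G"
    using z edges_verts[OF simple] by blast
  from Suc.IH[OF z(1)] show ?case
  proof (elim disjE conjE exE)
    fix m assume m: "z \<in> verts core" "m \<le> n" "(x, z) \<in> edges core ^^ m"
    show ?case
    proof (cases "valence G y = 1")
      case True
      then obtain q where "neighbors G y = {q}" "q \<in> verts core"
        using leaf_neighbor yV by blast
      moreover have "z \<in> neighbors G y"
        using z(2) edges_sym[OF simple] by (simp add: neighbors_def)
      ultimately show ?thesis
        using m by (intro disjI2 exI[of _ m]) auto
    next
      case False
      then have "(x, y) \<in> edges core ^^ Suc m"
        using m z(2) by (auto simp: edges_core verts_core)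
      then show ?thesis
        using m(2) False yV by (intro disjI1) (auto simp: verts_core intro!: exI[of _ "Suc m"])
    qed
  next
    fix m q assume "m < n" "neighbors G z = {q}" "q \<in> verts core" "(x, q) \<in> edges core ^^ m"
    moreover from this z(2) have "y = q"
      by (auto simp: neighbors_def)
    ultimately show ?case
      by (intro disjI1) (auto intro!: exI[of _ m])
  qed
qed

lemma core_walk_to_core:
  assumes "x \<in> verts core" "y \<in> verts core" "(x, y) \<in> edges G ^^ n"
  shows "\<exists>m\<le>n. (x, y) \<in> edges core ^^ m"
proof -
  have "neighbors G y \<noteq> {q}" for q
    using assms(2) by (auto simp: verts_core valence_def)
  then show ?thesis
    using core_walk[OF assms(1,3)] by blast
qed

lemma connected_core: "connected_graph core"
  unfolding connected_graph_def
proof (intro conjI ballI core_nonempty)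
  fix x y assume xy: "x \<in> verts core" "y \<in> verts core"
  then obtain n where "(x, y) \<in> edges G ^^ n"
    using graph_dist_relpow[OF conn] by (auto simp: verts_core)
  then show "(x, y) \<in> (edges core)\<^sup>*"
    using core_walk_to_core[OF xy] by (auto intro: relpow_imp_rtrancl)
qed

lemma subcubic_core: "subcubic core"
proof
  fix x assume x: "x \<in> verts core"
  then have xV: "x \<in> verts G"
    by (simp add: verts_core)
  show "finite (neighbors core x)"
    using fin[OF xV] by (simp add: neighbors_core[OF x])
  show "valence core x \<le> 3"
    unfolding valence_def neighbors_core[OF x]
    using neighbors_le_3(2)[OF Diff_subset xV] .
qed (simp_all add: simple_core connected_core)

lemma card_core_less: "card (verts core) < card (verts G)"
  using leaf_exists by (intro psubset_card_mono finite_verts) (auto simp: verts_core)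

text \<open>A vertex carrying leaves loses two of its three neighbors and so becomes a leaf of the
  core.\<close>

lemma valence_core:
  assumes p: "p \<in> verts core" and nb: "\<not> neighbors G p \<subseteq> leaves_at p"
  shows "valence core p = (if leaves_at p = {} then valence G p else 1)"
proof (cases "leaves_at p = {}")
  case False
  have pV: "p \<in> verts G"
    using p by (simp add: verts_core)
  have "leaves_at p \<subseteq> neighbors G p"
    by (auto simp: leaves_at_def)
  then have "valence core p = valence G p - card (leaves_at p)"
    unfolding valence_def neighbors_core[OF p]
    by (intro card_Diff_subset) (auto intro: finite_subset fin[OF pV])
  then show ?thesis
    using card_leaves_at[OF p False nb] False by simp
qed (simp add: valence_def neighbors_core[OF p])

section \<open>Stars, where the core is a single vertex\<close>

lemma star_verts:
  assumes p: "p \<in> verts core" and nb: "neighbors G p \<subseteq> leaves_at p"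
  shows "verts G = insert p (leaves_at p)"
proof -
  have pV: "p \<in> verts G"
    using p by (simp add: verts_core)
  have "y \<in> insert p (leaves_at p)" if "(p, y) \<in> (edges G)\<^sup>*" for y
    using that
  proof (induction rule: rtrancl_induct)
    case (step y z)
    then have z: "z \<in> neighbors G y"
      by (simp add: neighbors_def)
    show ?case
    proof (cases "y = p")
      case False
      then have "y \<in> neighbors G p" "valence G y = 1"
        using step.IH by (auto simp: leaves_at_def)
      then show ?thesis
        using leaf_unique_neighbor[of y z p] z neighbors_sym by auto
    qed (use z nb in auto)
  qed simp
  then have "verts G \<subseteq> insert p (leaves_at p)"
    using conn pV by (auto simp: connected_graph_def)
  then show ?thesis
    using pV neighbors_verts by (auto simp: leaves_at_def)
qed

text \<open>The center has valence 3 or 2. In the first case the graph is \<open>T\<^sub>1\<close>;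
  in the second it is a path on three vertices, and coloring one end black breaks its
  symmetry.\<close>

lemma star:
  assumes p: "p \<in> verts core" and nb: "neighbors G p \<subseteq> leaves_at p"
  shows "(\<exists>B. distinguishing G (\<lambda>x. x \<in> B)) \<or> is_T 1 G"
proof -
  have pV: "p \<in> verts G" and p1: "valence G p \<noteq> 1"
    using p by (auto simp: verts_core)
  have eq: "leaves_at p = neighbors G p"
    using nb by (auto simp: leaves_at_def)
  note V = star_verts[OF assms]
  have leaf: "x = p" if "x \<in> verts G" "valence G x \<noteq> 1" for x
    using that by (auto simp: V leaves_at_def)
  show ?thesis
  proof (cases "valence G p = 3")
    case True
    have "\<not> is_cycle G c" for c
    proof
      assume c: "is_cycle G c"
      \<comment> \<open>No vertex of a cycle is a leaf and \<open>p\<close> is the only non-leaf, so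
        the first two vertices of \<open>c\<close> coincide.\<close>
      have "c ! i = p" if "i < 2" for i
      proof -
        have e: "Suc i < length c" "(c ! i, c ! Suc i) \<in> edges G"
          using c that by (auto simp: is_cycle_def)
        then show ?thesis
          using leaf[of "c ! i"] cycle_vertex_not_leaf[OF c, of "c ! i"] edges_verts[OF simple] by simp
      qed
      from this[of 0] this[of 1] have "c ! 0 = c ! 1"
        by simp
      moreover have "distinct c" "0 < length c" "1 < length c"
        using c by (auto simp: is_cycle_def)
      ultimately show False
        using nth_eq_iff_index_eq zero_neq_one by metis
    qed
    moreover have "\<forall>x\<in>verts G. valence G x = 1 \<or> valence G x = 3"
      using leaf True by blast
    moreover have "graph_dist G p x = 1" if "x \<in> verts G" "valence G x = 1" for x
    proof -
      have "x \<noteq> p" "(p, x) \<in> edges G ^^ 1"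
        using that V eq p1 by (auto simp: neighbors_def)
      then show ?thesis
        using graph_dist_le[of p x 1 G] graph_dist_eq_0[OF conn pV that(1)] by auto
    qed
    ultimately have "is_T 1 G"
      using simple conn finite_verts pV unfolding is_T_def is_tree_def by blast
    then show ?thesis ..
  next
    case False
    obtain w where w: "w \<in> verts G" "valence G w = 1"
      using leaf_exists by blast
    then have wp: "w \<in> neighbors G p" "w \<noteq> p"
      using V eq p1 by auto
    have "neighbors G p \<noteq> {}"
      using wp by auto
    then have "valence G p = 2"
      using val3[OF pV] False p1 fin[OF pV] by (auto simp: valence_def le_Suc_eq numeral_eq_Suc)
    then obtain a b where "neighbors G p = {a, b}" "a \<noteq> b"
      by (auto simp: valence_def card_2_iff)
    then obtain z where z: "neighbors G p = {w, z}" "z \<noteq> w"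
      using wp(1) by (metis insertE insert_commute singletonD)
    have "distinguishing G (\<lambda>x. x \<in> {w})"
    proof (rule distinguishingI)
      fix f x
      assume f: "graph_iso G G f" and col: "\<And>x. x \<in> verts G \<Longrightarrow> f x \<in> {w} \<longleftrightarrow> x \<in> {w}"
        and x: "x \<in> verts G"
      have zV: "z \<in> verts G"
        using z neighbors_verts by blast
      have "f w = w"
        using col[OF w(1)] by simp
      moreover have "f p = p"
        using leaf[OF graph_iso_in[OF f pV]] graph_iso_valence[OF simple f pV] p1 by simp
      moreover have "z \<noteq> p"
        using z(1) eq p1 by (auto simp: leaves_at_def)
      then have "f z \<noteq> w" "f z \<noteq> p"
        using graph_iso_eq_iff[OF f zV] w(1) pV z(2) calculation by metis+
      ultimately show "f x = x"
        using x graph_iso_in[OF f zV] z unfolding V eq by auto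
    qed
    then show ?thesis
      by blast
  qed
qed

section \<open>From the core back to the graph\<close>

lemma core_leaf:
  assumes "\<And>p. p \<in> verts core \<Longrightarrow> \<not> neighbors G p \<subseteq> leaves_at p"
  shows "\<exists>p\<in>verts core. valence core p = 1"
proof -
  obtain w where w: "w \<in> verts G" "valence G w = 1"
    using leaf_exists by blast
  then obtain p where p: "neighbors G w = {p}" "p \<in> verts core"
    using leaf_neighbor by blast
  then have "w \<in> leaves_at p"
    using w neighbors_sym by (auto simp: leaves_at_def)
  then show ?thesis
    using p valence_core assms by auto
qed

text \<open>Automorphisms preserve valences and so restrict to the core, which they fix pointwise by
  the choice of \<open>C\<close>. A leaf can then only be exchanged with the other leaf at its
  neighbor, and exactly one of the two is black.\<close>

lemma extend_two_coloring:
  assumes nb: "\<And>p. p \<in> verts core \<Longrightarrow> \<not> neighbors G p \<subseteq> leaves_at p"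
    and C: "distinguishing core (\<lambda>x. x \<in> C)"
  shows "\<exists>B. distinguishing G (\<lambda>x. x \<in> B)"
proof -
  define pick where "pick p = (SOME w. w \<in> leaves_at p)" for p
  have pick: "pick p \<in> leaves_at p" if "leaves_at p \<noteq> {}" for p
    unfolding pick_def using that by (simp add: some_in_eq)
  define B where "B = (C \<inter> verts core) \<union> {w. valence G w = 1 \<and> (\<exists>p. neighbors G w = {p} \<and> w = pick p)}"
  have "distinguishing G (\<lambda>x. x \<in> B)"
  proof (rule distinguishingI)
    fix f x
    assume f: "graph_iso G G f" and col: "\<And>x. x \<in> verts G \<Longrightarrow> f x \<in> B \<longleftrightarrow> x \<in> B"
      and x: "x \<in> verts G"
    have fV: "f y \<in> verts core \<longleftrightarrow> y \<in> verts core" if "y \<in> verts G" for y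
      using graph_iso_in[OF f that] graph_iso_valence[OF simple f that] that by (simp add: verts_core)
    have sub: "verts core \<subseteq> verts G"
      by (auto simp: verts_core)
    have "f ` verts core = verts core"
    proof
      show "verts core \<subseteq> f ` verts core"
      proof
        fix y assume y: "y \<in> verts core"
        then obtain z where "z \<in> verts G" "f z = y"
          using graph_iso_onto[OF f] sub by blast
        then show "y \<in> f ` verts core"
          using fV y by auto
      qed
    qed (use fV sub in auto)
    moreover have "inj_on f (verts core)"
      using f sub by (auto simp: graph_iso_def bij_betw_def intro: inj_on_subset)
    ultimately have "graph_iso core core f"
      using f sub graph_iso_valence[OF simple f]
      by (auto simp: graph_iso_def bij_betw_def edges_core subset_iff)
    moreover have "f y \<in> C \<longleftrightarrow> y \<in> C" if "y \<in> verts core" for y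
      using col[of y] fV[of y] that sub by (auto simp: B_def verts_core)
    ultimately have fixed: "f y = y" if "y \<in> verts core" for y
      using C that unfolding distinguishing_def by blast
    show "f x = x"
    proof (cases "valence G x = 1")
      case True
      then obtain p where p: "neighbors G x = {p}" "p \<in> verts core"
        using leaf_neighbor x by blast
      have fx: "neighbors G (f x) = {p}" "valence G (f x) = 1"
        using graph_iso_neighbors[OF simple f x] p fixed graph_iso_valence[OF simple f x] True by auto
      then have in_p: "x \<in> leaves_at p" "f x \<in> leaves_at p"
        using p True neighbors_sym by (auto simp: leaves_at_def)
      have iff: "y \<in> B \<longleftrightarrow> y = pick p" if "neighbors G y = {p}" "valence G y = 1" for y
        using that by (auto simp: B_def verts_core)
      have "card (leaves_at p) = 2"
        using card_leaves_at(1)[OF p(2) _ nb[OF p(2)]] in_p by blast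
      then have "f x = x \<or> x = pick p \<or> f x = pick p"
        using in_p pick[of p] by (auto simp: card_2_iff)
      then show ?thesis
        using iff[OF p(1) True] iff[OF fx] col[OF x] by auto
    qed (use fixed x in \<open>simp add: verts_core\<close>)
  qed
  then show ?thesis
    by blast
qed

text \<open>The root is kept. Each leaf of \<open>G\<close> hangs at a leaf of the core, one step
  further from the root, and cycles of \<open>G\<close> would already lie in the core.\<close>

lemma extend_T:
  assumes nb: "\<And>p. p \<in> verts core \<Longrightarrow> \<not> neighbors G p \<subseteq> leaves_at p"
    and T: "is_T n core"
  shows "is_T (Suc n) G"
proof -
  obtain r where r: "r \<in> verts core"
    and dist_r: "\<And>q. q \<in> verts core \<Longrightarrow> valence core q = 1 \<Longrightarrow> graph_dist core r q = n"
    using T unfolding is_T_def by blast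
  have rV: "r \<in> verts G"
    using r by (simp add: verts_core)
  have valG: "valence G x = 1 \<or> valence G x = 3" if "x \<in> verts G" for x
  proof (cases "x \<in> verts core")
    case True
    then have "valence core x = 1 \<or> valence core x = 3"
      using T by (simp add: is_T_def)
    then show ?thesis
      using valence_core[OF True nb[OF True]] card_leaves_at(2)[OF True _ nb[OF True]]
      by (auto split: if_splits)
  qed (use that in \<open>simp add: verts_core\<close>)
  have dist: "graph_dist G r w = Suc n" if w: "w \<in> verts G" "valence G w = 1" for w
  proof -
    obtain q where q: "neighbors G w = {q}" "q \<in> verts core"
      using leaf_neighbor w by blast
    have wq: "w \<in> leaves_at q"
      using q w neighbors_sym by (auto simp: leaves_at_def)
    then have "valence core q = 1"
      using valence_core[OF q(2) nb[OF q(2)]] by auto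
    then have n: "graph_dist core r q = n"
      using dist_r q(2) by blast
    have "(r, q) \<in> edges core ^^ n"
      using graph_dist_relpow[OF connected_core r q(2)] n by simp
    moreover have "(q, w) \<in> edges G"
      using wq by (simp add: leaves_at_def neighbors_def)
    ultimately have le: "graph_dist G r w \<le> Suc n"
      by (intro graph_dist_le) (auto dest: relpow_core_subset)
    \<comment> \<open>Cutting off the final step to the leaf gives a core walk to \<open>q\<close>
      that is strictly shorter, hence the lower bound.\<close>
    obtain m where m: "m < graph_dist G r w" "(r, q) \<in> edges core ^^ m"
      using core_walk[OF r graph_dist_relpow[OF conn rV w(1)]] q w by (auto simp: verts_core)
    then have "n < graph_dist G r w"
      using graph_dist_le[OF m(2)] n by linarith
    then show ?thesis
      using le by simp
  qed
  have "\<not> is_cycle G c" for c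
  proof
    assume c: "is_cycle G c"
    then have "c \<noteq> []"
      by (auto simp: is_cycle_def)
    then have "is_cycle core c"
      using c cycle_vertex_not_leaf[OF c] by (auto simp: is_cycle_def edges_core)
    then show False
      using T by (auto simp: is_T_def is_tree_def)
  qed
  then show ?thesis
    using simple conn finite_verts valG rV dist unfolding is_T_def is_tree_def by blast
qed

end

text \<open>Induction on the number of vertices. An unpaired leaf gives a coloring directly;
  otherwise the graph is a star, or its core is smaller and again has a leaf.\<close>

lemma finite_subcubic_leaf:
  assumes "subcubic G" "finite (verts G)" "\<exists>v\<in>verts G. valence G v = 1"
  shows "(\<exists>B. distinguishing G (\<lambda>x. x \<in> B)) \<or> (\<exists>n\<ge>1. is_T n G)"
  using assms
proof (induction "card (verts G)" arbitrary: G rule: less_induct)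
  case less
  interpret subcubic G
    by (rule less.prems)
  show ?case
  proof (cases "\<forall>w\<in>verts G. valence G w = 1 \<longrightarrow>
      (\<exists>w'\<in>verts G. w' \<noteq> w \<and> valence G w' = 1 \<and> neighbors G w' = neighbors G w)")
    case True
    then interpret paired_leaves G
      using less.prems by unfold_locales auto
    show ?thesis
    proof (cases "\<exists>p\<in>verts core. neighbors G p \<subseteq> leaves_at p")
      case True
      then show ?thesis
        using star by blast
    next
      case False
      then have nb: "\<And>p. p \<in> verts core \<Longrightarrow> \<not> neighbors G p \<subseteq> leaves_at p"
        by blast
      have "finite (verts core)"
        using finite_verts by (simp add: core_def)
      then have "(\<exists>B. distinguishing core (\<lambda>x. x \<in> B)) \<or> (\<exists>n\<ge>1. is_T n core)"
        using less.hyps card_core_less subcubic_core core_leaf nb by blast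
      then show ?thesis
        using extend_two_coloring[OF nb] extend_T[OF nb] le_SucI by metis
    qed
  next
    case False
    then obtain v where unpaired: "v \<in> verts G" "valence G v = 1"
      "\<And>w. w \<in> verts G \<Longrightarrow> w \<noteq> v \<Longrightarrow> valence G w = 1 \<Longrightarrow> neighbors G w \<noteq> neighbors G v"
      by blast
    interpret rooted_at_leaf G v
      using unpaired by unfold_locales
    show ?thesis
      using finite_two_coloring less.prems(2) unpaired(3) by blast
  qed
qed

lemma distinguishing_number_le_2:
  assumes "distinguishing G (\<lambda>x. x \<in> B)"
  shows "distinguishing_number G \<le> 2"
proof -
  define c :: "'a \<Rightarrow> nat" where "c x = (if x \<in> B then 1 else 0)" for x
  have "c x = c y \<longleftrightarrow> (x \<in> B) = (y \<in> B)" for x y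
    by (simp add: c_def)
  then have "distinguishing G c"
    using assms by (simp add: distinguishing_def)
  moreover have "c ` verts G \<subseteq> {..<2}"
    by (auto simp: c_def)
  ultimately have "distinguishing_number G \<le> enat 2"
    unfolding distinguishing_number_def by (intro Inf_lower) blast
  then show ?thesis
    by (simp add: numeral_eq_enat)
qed

theorem theorem4p1:
  fixes G :: "'a graph"
  assumes "simple_graph G"
    and "connected_graph G"
    and "has_max_valence G 3"
    and "\<exists>v\<in>verts G. valence G v = 1"
  shows "distinguishing_number G \<le> 2 \<or>
    (\<exists>n\<ge>1. \<exists>T :: 'a graph. is_T n T \<and> isomorphic G T)"
proof -
  interpret subcubic G
    using assms by unfold_locales (auto simp: has_max_valence_def)
  obtain v where "v \<in> verts G" "valence G v = 1"
    using assms(4) by blast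
  then interpret rooted_at_leaf G v
    by unfold_locales
  \<comment> \<open>The finite case shows that \<open>G\<close> itself satisfies
    \<open>is_T\<close>, so \<open>G\<close> serves as the witness \<open>T\<close>.\<close>
  have "isomorphic G G"
    unfolding isomorphic_def graph_iso_def by (rule exI[of _ id]) simp
  then show ?thesis
    using infinite_two_coloring finite_subcubic_leaf[OF subcubic_axioms _ assms(4)]
      distinguishing_number_le_2 by blast
qed

end
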